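(* Let $R=k[x_1,\ldots,x_n]$ be a polynomial ring and let $x^A=x_{i_1}^{\alpha_{i_1}}\cdots x_{i_s}^{\alpha_{i_s}}$ be a monomial of $R$ with $\alpha_{i_1},\ldots,\alpha_{i_s}>0$ and $1\le i_1<\cdots<i_s\le n$. Put $i_{s+1}=n+1$. Let $P(x^A)$ be the set of all monomials of $R$ which can be Borel-specialized to $x^A$. Then $$|P(x^A)|\ \ge\ \sum_{t=1}^s\binom{\alpha_{i_1}+\cdots+\alpha_{i_t}+i_{t+1}-i_t-1}{i_{t+1}-i_t-1}-s+1.$$
   Context: A monomial $x^B$ is a Borel specialization of a monomial $x^C=\prod_{i=1}^n x_i^{c_i}$ if $x^B$ is obtained from $x^C$ by replacing every variable $x_i$ by a variable $x_{j_i}$ with $j_i\le i$; that is, $x^B=\prod_{i=1}^n x_{j_i}^{c_i}$ for some indices $1\le j_i\le i$ (all occurrences of the same variable $x_i$ are replaced by the same variable $x_{j_i}$). One says $x^C$ can be Borel-specialized to $x^B$. Thus $P(x^A)$ is the set of monomials $x^C$ of $R$ having $x^A$ as a Borel specialization. *)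

theory Defs
  imports Complex_Main "HOL-Library.Poly_Mapping"
begin

text \<open>
  Polynomials over \<open>'k\<close> are finitely supported functions from exponent vectors to coefficients,
  with the convolution product of \<open>Poly_Mapping\<close>. The variables are indexed by all of \<open>nat\<close>;
  the ring \<open>R = k[x_1, ..., x_n]\<close> is the part involving only the variables with indices in \<open>{1..n}\<close>.
\<close>

type_synonym 'k mpoly = "(nat \<Rightarrow>\<^sub>0 nat) \<Rightarrow>\<^sub>0 'k"

definition Var :: "nat \<Rightarrow> 'k::field mpoly" where
  "Var i = Poly_Mapping.single (Poly_Mapping.single i 1) 1"

definition xpow :: "nat \<Rightarrow> (nat \<Rightarrow> nat) \<Rightarrow> 'k::field mpoly" where
  "xpow n c = (\<Prod>i=1..n. Var i ^ c i)"

definition monomials :: "nat \<Rightarrow> 'k::field mpoly set" where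
  "monomials n = range (xpow n)"

text \<open>
  \<open>borel_specialization n B C\<close>: the monomial \<open>B\<close> is a Borel specialization of the monomial \<open>C\<close>.
  The variable \<open>x_i\<close> is replaced by \<open>x_{j i}\<close>; as \<open>j\<close> is a function of the variable,
  all occurrences of \<open>x_i\<close> are replaced by the same one.
\<close>

definition borel_specialization :: "nat \<Rightarrow> 'k::field mpoly \<Rightarrow> 'k mpoly \<Rightarrow> bool" where
  "borel_specialization n B C \<longleftrightarrow>
     (\<exists>c j. C = xpow n c \<and> (\<forall>i\<in>{1..n}. 1 \<le> j i \<and> j i \<le> i) \<and> B = (\<Prod>i=1..n. Var (j i) ^ c i))"

definition P :: "nat \<Rightarrow> 'k::field mpoly \<Rightarrow> 'k mpoly set" where
  "P n B = {C \<in> monomials n. borel_specialization n B C}"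

end

theory Submission
  imports Defs "HOL-Library.Multiset"
begin

text \<open>
  A monomial is a multiset of variables, and a Borel specialization maps every variable to
  a smaller one or to itself. Write \<open>A\<close> for the given multiset, with distinct variables
  \<open>i\<^sub>1 < \<dots> < i\<^sub>s\<close>, and call the variables strictly between \<open>i\<^sub>t\<close> and \<open>i\<^bsub>t+1\<^esub>\<close> the
  gap at \<open>t\<close>; there are \<open>m = i\<^bsub>t+1\<^esub> - i\<^sub>t - 1\<close> of them. For each \<open>t\<close> a family of
  multisets specializing to \<open>A\<close> is obtained as follows.

  The part of \<open>A\<close> in the variables up to \<open>i\<^sub>t\<close> is a sorted word of some length \<open>d\<close> over the
  letters \<open>1, \<dots>, t\<close>, the letter \<open>r\<close> standing for \<open>i\<^sub>r\<close>. The letters \<open>t + 1, \<dots>, t + m\<close> stand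
  for the gap variables. Add to this word, letter by letter, a sorted word of length \<open>d\<close> with
  entries in \<open>{0..m}\<close>. Such a summand is the same thing as a multiset of size \<open>d\<close> in
  \<open>{0..m}\<close>, so there are \<open>(d + m) choose m\<close> of them. Both words being sorted, two positions
  can carry the same letter in the sum only if they carry the same letter in both words.
  Hence each letter of the sum determines the letter of the original word below it, which is
  what a Borel specialization requires (\<open>raise_factors\<close>). The sum is sorted too, so the multiset
  of its letters determines it, and with it the summand (\<open>inj_on_mset_raise\<close>). The remaining
  variables of \<open>A\<close> are kept.

  If the summand is not constantly \<open>0\<close>, its last entry is positive, while the last letter of
  the original word is \<open>t\<close>; hence the resulting multiset contains a variable of the gap at \<open>t\<close>
  (\<open>raise_nonzero_exceeds_top\<close>), and it contains none from any other gap. So the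
  \<open>((d + m) choose m) - 1\<close> multisets for \<open>t\<close> differ from those for other values
  of \<open>t\<close> and from \<open>A\<close> itself (\<open>card_borel_generalizations_ge\<close>). Adding up over \<open>t\<close> and
  counting \<open>A\<close> once gives the bound.
\<close>

section \<open>Raising a sorted word\<close>

definition raise :: "nat multiset \<Rightarrow> nat list \<Rightarrow> nat list" where
  "raise M rs = map2 (+) (sorted_list_of_multiset M) rs"

lemma length_sorted_list_of_multiset: "length (sorted_list_of_multiset M) = size M"
  by (metis mset_sorted_list_of_multiset size_mset)

lemma length_raise: "size M = length rs \<Longrightarrow> length (raise M rs) = length rs"
  by (simp add: raise_def length_sorted_list_of_multiset)

lemma nth_raise:
  assumes "size M = length rs" and "u < length rs"
  shows "raise M rs ! u = sorted_list_of_multiset M ! u + rs ! u"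
  using assms by (simp add: raise_def length_sorted_list_of_multiset)

lemma sorted_raise:
  assumes "size M = length rs" and "sorted rs"
  shows "sorted (raise M rs)"
proof -
  have "sorted_list_of_multiset M ! u \<le> sorted_list_of_multiset M ! w" "rs ! u \<le> rs ! w"
    if "u \<le> w" "w < length rs" for u w
    using assms that
    by (auto intro!: sorted_nth_mono simp: length_sorted_list_of_multiset)
  then show ?thesis
    unfolding sorted_iff_nth_mono using assms(1)
    by (auto simp: length_raise nth_raise intro: add_mono)
qed

text \<open>
  The raised word is sorted, so its letters determine it, and subtracting \<open>rs\<close> gives back \<open>M\<close>.
\<close>

lemma inj_on_mset_raise:
  assumes "sorted rs"
  shows "inj_on (\<lambda>M. mset (raise M rs)) {M. size M = length rs}"
proof (rule inj_onI; clarify)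
  fix M N :: "nat multiset"
  assume M: "size M = length rs" and N: "size N = length rs"
    and eq: "mset (raise M rs) = mset (raise N rs)"
  have raise_eq: "raise M rs = raise N rs"
    using eq M N assms by (metis properties_for_sort sorted_raise)
  have "sorted_list_of_multiset M = sorted_list_of_multiset N"
  proof (rule nth_equalityI)
    fix u assume "u < length (sorted_list_of_multiset M)"
    then have "u < length rs" by (simp add: length_sorted_list_of_multiset M)
    then show "sorted_list_of_multiset M ! u = sorted_list_of_multiset N ! u"
      using nth_raise[OF M, of u] nth_raise[OF N, of u] raise_eq by simp
  qed (simp add: length_sorted_list_of_multiset M N)
  then show "M = N" by (metis mset_sorted_list_of_multiset)
qed

text \<open>
  Both summands increase with the position, so a letter that occurs twice in the sum comes from
  equal letters of \<open>rs\<close>; this makes the map \<open>q\<close> back to \<open>rs\<close> well defined. The third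
  property keeps \<open>q\<close> inside any set of letters that contains those of \<open>rs\<close>.
\<close>

lemma raise_factors:
  assumes size: "size M = length rs" and "sorted rs"
  obtains q where "map q (raise M rs) = rs" and "\<And>k. q k \<le> k"
    and "\<And>k. q k = k \<or> q k \<in> set rs"
proof -
  let ?K = "raise M rs"
  have same: "rs ! u = rs ! w" if "u \<le> w" "w < length rs" "?K ! u = ?K ! w" for u w
  proof -
    have "sorted_list_of_multiset M ! u \<le> sorted_list_of_multiset M ! w" "rs ! u \<le> rs ! w"
      using assms that by (auto intro!: sorted_nth_mono simp: length_sorted_list_of_multiset)
    then show ?thesis using that by (simp add: nth_raise[OF size])
  qed
  have same': "rs ! u = rs ! w" if "u < length rs" "w < length rs" "?K ! u = ?K ! w" for u w
  proof (cases "u \<le> w")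
    case True
    then show ?thesis using that by (intro same)
  next
    case False
    then have "rs ! w = rs ! u" using that by (intro same) simp_all
    then show ?thesis by (rule sym)
  qed
  \<comment> \<open>Any position of the letter serves, as they all carry the same letter of \<open>rs\<close>.\<close>
  define pos where "pos k = (SOME u. u < length rs \<and> ?K ! u = k)" for k
  have pos: "pos k < length rs" "?K ! pos k = k" if "k \<in> set ?K" for k
  proof -
    have "\<exists>u. u < length rs \<and> ?K ! u = k"
      using that by (auto simp: in_set_conv_nth length_raise[OF size])
    from someI_ex[OF this] show "pos k < length rs" "?K ! pos k = k"
      by (simp_all add: pos_def)
  qed
  define q where "q k = (if k \<in> set ?K then rs ! pos k else k)" for k
  show thesis
  proof
    show "map q ?K = rs"
    proof (rule nth_equalityI)
      fix u assume "u < length (map q ?K)"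
      then have u: "u < length rs" by (simp add: length_raise[OF size])
      then have "?K ! u \<in> set ?K" by (simp add: length_raise[OF size])
      then show "map q ?K ! u = rs ! u"
        using u pos[of "?K ! u"] same'[of "pos (?K ! u)" u]
        by (simp add: q_def length_raise[OF size])
    qed (simp add: length_raise[OF size])
    show "q k \<le> k" for k
      using pos[of k] nth_raise[OF size, of "pos k"] by (auto simp: q_def)
    show "q k = k \<or> q k \<in> set rs" for k
      using pos[of k] by (auto simp: q_def)
  qed
qed

text \<open>
  The positive entries of the sorted summand include its last one, and the last letter
  of \<open>rs\<close> is at least \<open>t\<close>.
\<close>

lemma raise_nonzero_exceeds_top:
  assumes size: "size M = length rs" and "sorted rs"
    and M: "M \<noteq> replicate_mset (length rs) 0" and top: "t \<in> set rs"
  obtains k where "k \<in> set (raise M rs)" and "t < k"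
proof -
  let ?d = "length rs - 1"
  let ?xs = "sorted_list_of_multiset M"
  have ne: "rs \<noteq> []" using top by auto
  obtain u where u: "u < length rs" "rs ! u = t" using top by (auto simp: in_set_conv_nth)
  have "rs ! u \<le> rs ! ?d"
    using u assms(2) by (intro sorted_nth_mono) auto
  obtain x where x: "x \<in># M" "x \<noteq> 0"
  proof (rule ccontr)
    assume "\<not> thesis"
    then have "set_mset M \<subseteq> {0}" using that by auto
    then have "M = replicate_mset (size M) 0"
      by (metis set_mset_subset_singletonD)
    with M size show False by simp
  qed
  have "x \<in> set ?xs"
    using x by simp
  then obtain w where w: "w < length rs" "?xs ! w = x"
    using size unfolding in_set_conv_nth length_sorted_list_of_multiset by auto
  have "?xs ! w \<le> ?xs ! ?d"
    using w size by (intro sorted_nth_mono) (auto simp: length_sorted_list_of_multiset)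
  then have "t < raise M rs ! ?d"
    using \<open>rs ! u \<le> rs ! ?d\<close> ne u w x nth_raise[OF size, of ?d] by simp
  moreover have "raise M rs ! ?d \<in> set (raise M rs)"
    using ne by (intro nth_mem) (simp add: length_raise[OF size])
  ultimately show thesis using that by blast
qed

lemma set_raise_bounds:
  assumes size: "size M = length rs" and "set_mset M \<subseteq> {..m}" and "set rs \<subseteq> {1..t}"
  shows "set (raise M rs) \<subseteq> {1..t + m}"
proof
  fix k assume "k \<in> set (raise M rs)"
  then obtain u where u: "u < length rs" "k = raise M rs ! u"
    by (auto simp: in_set_conv_nth length_raise[OF size])
  have "rs ! u \<in> {1..t}" using u assms(3) nth_mem by blast
  moreover have "sorted_list_of_multiset M ! u \<in># M"
    using u size
    by (metis length_sorted_list_of_multiset mset_sorted_list_of_multiset nth_mem_mset)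
  ultimately show "k \<in> {1..t + m}"
    using u assms(2) by (auto simp: nth_raise[OF size])
qed

section \<open>Borel specialization of multisets of variables\<close>

definition borel_generalizations :: "nat \<Rightarrow> nat multiset \<Rightarrow> nat multiset set" where
  "borel_generalizations n A =
     {C. set_mset C \<subseteq> {1..n} \<and>
         (\<exists>j. (\<forall>k\<in>{1..n}. 1 \<le> j k \<and> j k \<le> k) \<and> image_mset j C = A)}"

lemma image_mset_sum_replicate:
  assumes "finite I"
  shows "image_mset f (\<Sum>k\<in>I. replicate_mset (c k) (g k)) = (\<Sum>k\<in>I. replicate_mset (c k) (f (g k)))"
  using assms by (induction I rule: finite_induct) simp_all

lemma finite_borel_generalizations: "finite (borel_generalizations n A)"
proof (rule finite_subset)
  show "borel_generalizations n A \<subseteq> multisets_of_size {1..n} (size A)"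
    by (auto simp: borel_generalizations_def multisets_of_size_def)
qed auto

lemma self_in_borel_generalizations:
  "set_mset A \<subseteq> {1..n} \<Longrightarrow> A \<in> borel_generalizations n A"
  unfolding borel_generalizations_def by (auto intro!: exI[of _ id])

text \<open>
  The contribution of one gap. The map \<open>v\<close> translates letters into variables: \<open>1, \<dots>, t\<close> are the
  variables of the word and \<open>t + 1, \<dots>, t + m\<close> those of the gap; \<open>A'\<close> is the part of the
  multiset that stays untouched. The summand \<open>1\<close> on the right accounts for the zero word,
  which reproduces the given multiset and misses the gap.
\<close>

lemma card_generalizations_through_gap:
  fixes v :: "nat \<Rightarrow> nat" and t m n :: nat
  defines "V \<equiv> v ` {1..t + m}"
  assumes v: "strict_mono_on {1..t + m} v" and V: "V \<subseteq> {1..n}"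
    and rs: "sorted rs" "set rs \<subseteq> {1..t}" "t \<in> set rs"
    and A': "set_mset A' \<subseteq> {1..n}" "set_mset A' \<inter> V = {}"
  shows "(length rs + m) choose m \<le>
    card {C \<in> borel_generalizations n (image_mset v (mset rs) + A').
            set_mset C \<subseteq> V \<union> set_mset A' \<and> set_mset C \<inter> v ` {t + 1..t + m} \<noteq> {}} + 1"
    (is "_ \<le> card ?Q + 1")
proof -
  let ?S = "multisets_of_size {..m} (length rs)"
  let ?Z = "replicate_mset (length rs) (0::nat)"
  define f where "f M = image_mset v (mset (raise M rs)) + A'" for M
  have inj_v: "inj_on v {1..t + m}" using v by (rule strict_mono_on_imp_inj_on)
  have S: "size M = length rs" "set_mset M \<subseteq> {..m}" if "M \<in> ?S" for M
    using that by (auto simp: multisets_of_size_def)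
  have raise_sub: "set (raise M rs) \<subseteq> {1..t + m}" if "M \<in> ?S" for M
    using set_raise_bounds[OF S[OF that]] rs(2) by simp
  have inj_f: "inj_on f ?S"
  proof (rule inj_onI)
    fix M N assume M: "M \<in> ?S" and N: "N \<in> ?S" and "f M = f N"
    then have img: "image_mset v (mset (raise M rs)) = image_mset v (mset (raise N rs))"
      by (simp add: f_def)
    have "image_mset (inv_into {1..t + m} v) (image_mset v (mset (raise K rs))) = mset (raise K rs)"
      if "K \<in> ?S" for K
    proof -
      have "image_mset (inv_into {1..t + m} v \<circ> v) (mset (raise K rs))
          = image_mset id (mset (raise K rs))"
        using raise_sub[OF that] inj_v by (intro image_mset_cong) auto
      then show ?thesis by (simp add: multiset.map_comp)
    qed
    then have "mset (raise M rs) = mset (raise N rs)" using img M N by metis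
    then show "M = N"
      using inj_on_mset_raise[OF rs(1)] S(1)[OF M] S(1)[OF N] by (auto dest: inj_onD)
  qed
  have f_in: "f M \<in> ?Q" if M: "M \<in> ?S - {?Z}" for M
  proof -
    have MS: "M \<in> ?S" using M by simp
    note sz = S(1)[OF MS]
    obtain q where q: "map q (raise M rs) = rs" "\<And>k. q k \<le> k"
        "\<And>k. q k = k \<or> q k \<in> set rs"
      using raise_factors[OF sz rs(1)] by metis
    have q_in: "q k \<in> {1..t + m}" if "k \<in> {1..t + m}" for k
      using q(2)[of k] q(3)[of k] rs(2) that by auto
    \<comment> \<open>Transport \<open>q\<close> from letters to variables, and fix the variables that stand for no letter.\<close>
    define j where "j y = (if y \<in> V then v (q (inv_into {1..t + m} v y)) else y)" for y
    have j_v: "j (v k) = v (q k)" if "k \<in> {1..t + m}" for k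
      using that inj_v by (simp add: j_def V_def)
    have "1 \<le> j y \<and> j y \<le> y" if "y \<in> {1..n}" for y
    proof (cases "y \<in> V")
      case True
      then obtain k where k: "k \<in> {1..t + m}" "y = v k" by (auto simp: V_def)
      have "v (q k) \<in> V" using q_in[OF k(1)] by (simp add: V_def)
      moreover have "v (q k) \<le> v k"
        using strict_mono_on_leD[OF v q_in[OF k(1)] k(1) q(2)] .
      ultimately show ?thesis using k j_v V by auto
    next
      case False
      with that show ?thesis by (simp add: j_def)
    qed
    moreover have "image_mset j (f M) = image_mset v (mset rs) + A'"
    proof -
      have "image_mset j (image_mset v (mset (raise M rs)))
          = image_mset v (image_mset q (mset (raise M rs)))"
        unfolding multiset.map_comp o_def
        using raise_sub[OF MS] j_v by (intro image_mset_cong) auto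
      also have "image_mset q (mset (raise M rs)) = mset rs"
        using q(1) by (metis mset_map)
      finally have "image_mset j (image_mset v (mset (raise M rs))) = image_mset v (mset rs)" .
      moreover have "image_mset j A' = image_mset id A'"
        using A'(2) by (intro image_mset_cong) (auto simp: j_def)
      ultimately show ?thesis by (simp add: f_def)
    qed
    moreover have sub: "set_mset (f M) \<subseteq> V \<union> set_mset A'"
      using raise_sub[OF MS] by (auto simp: f_def V_def)
    moreover have "set_mset (f M) \<inter> v ` {t + 1..t + m} \<noteq> {}"
    proof -
      obtain k where k: "k \<in> set (raise M rs)" "t < k"
        using raise_nonzero_exceeds_top[OF sz rs(1) _ rs(3)] M by blast
      then have "v k \<in> set_mset (f M)" "v k \<in> v ` {t + 1..t + m}"
        using raise_sub[OF MS] by (auto simp: f_def)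
      then show ?thesis by blast
    qed
    ultimately show ?thesis
      using V A'(1) unfolding borel_generalizations_def by blast
  qed
  have "card (?S - {?Z}) \<le> card ?Q"
  proof (rule card_inj_on_le)
    show "inj_on f (?S - {?Z})" using inj_f by (rule inj_on_subset) auto
    show "f ` (?S - {?Z}) \<subseteq> ?Q" using f_in by blast
    show "finite ?Q" using finite_borel_generalizations by (rule finite_subset[rotated]) auto
  qed
  moreover have "card ?S = (length rs + m) choose m"
  proof -
    have "card ?S = (length rs + m) choose (length rs)"
      by (simp add: card_multisets_of_size add.commute)
    then show ?thesis using binomial_symmetric[of m "length rs + m"] by simp
  qed
  moreover have "card ?S \<le> card (?S - {?Z}) + 1"
    by (cases "?Z \<in> ?S") (auto simp: card_Diff_singleton_if)
  ultimately show ?thesis by linarith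
qed

text \<open>
  The sets \<open>Q t\<close> are told apart by the only gap that their members meet, and \<open>A\<close> meets no gap.
  The convention \<open>i (s + 1) = n + 1\<close> makes the last gap reach up to the variable \<open>n\<close>. The term \<open>s\<close>
  stands on the right because subtraction of natural numbers truncates.
\<close>

lemma card_borel_generalizations_ge:
  fixes i a :: "nat \<Rightarrow> nat" and s n :: nat
  defines "A \<equiv> (\<Sum>r=1..s. replicate_mset (a r) (i r))"
  assumes i: "strict_mono_on {1..s + 1} i" and i_pos: "\<forall>t\<in>{1..s}. 1 \<le> i t"
    and i_end: "i (s + 1) = n + 1" and a: "\<forall>t\<in>{1..s}. a t > 0"
  shows "(\<Sum>t=1..s. ((\<Sum>r=1..t. a r) + (i (t + 1) - i t - 1)) choose (i (t + 1) - i t - 1)) + 1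
    \<le> card (borel_generalizations n A) + s"
proof -
  define gap where "gap t = {i t<..<i (t + 1)}" for t
  define Q where "Q t = {C \<in> borel_generalizations n A.
      set_mset C \<subseteq> i ` {1..s} \<union> gap t \<and> set_mset C \<inter> gap t \<noteq> {}}" for t
  have i_less: "i r < i t" if "r < t" "1 \<le> r" "t \<le> s + 1" for r t
    using that by (intro strict_mono_onD[OF i]) auto
  have i_le: "i r \<le> i t" if "r \<le> t" "1 \<le> r" "t \<le> s + 1" for r t
    using that i_less[of r t] by (cases "r = t") auto
  have i_n: "i t \<le> n" if "1 \<le> t" "t \<le> s" for t
    using i_less[of t "s + 1"] that i_end by simp
  have gap_i: "i r \<notin> gap t" if "r \<in> {1..s}" "t \<in> {1..s}" for r t
    using i_le[of r t] i_le[of "t + 1" r] that by (cases "r \<le> t") (auto simp: gap_def)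
  have gap_gap: "gap t \<inter> gap t' = {}" if "t < t'" "1 \<le> t" "t' \<le> s" for t t'
    using i_le[of "t + 1" t'] that by (auto simp: gap_def)
  have set_A: "set_mset A \<subseteq> i ` {1..s}"
    by (auto simp: A_def set_mset_sum)

  have block: "((\<Sum>r=1..t. a r) + (i (t + 1) - i t - 1)) choose (i (t + 1) - i t - 1)
      \<le> card (Q t) + 1" if t: "t \<in> {1..s}" for t
  proof -
    define m where "m = i (t + 1) - i t - 1"
    define v where "v k = (if k \<le> t then i k else i t + (k - t))" for k
    define rs where "rs = sorted_list_of_multiset (\<Sum>r=1..t. replicate_mset (a r) r)"
    define A' where "A' = (\<Sum>r=t + 1..s. replicate_mset (a r) (i r))"
    have it: "i (t + 1) = i t + m + 1" using i_less[of t "t + 1"] t by (simp add: m_def)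
    have itn: "i t + m \<le> n" using it i_le[of "t + 1" "s + 1"] t i_end by simp
    have mset_rs: "mset rs = (\<Sum>r=1..t. replicate_mset (a r) r)" by (simp add: rs_def)
    have v: "strict_mono_on {1..t + m} v"
    proof (rule strict_mono_onI)
      fix k l assume "k \<in> {1..t + m}" "l \<in> {1..t + m}" "k < l"
      then show "v k < v l"
        using i_less[of k l] i_le[of k t] t by (auto simp: v_def)
    qed
    have V: "v ` {1..t + m} = i ` {1..t} \<union> gap t"
      and top: "v ` {t + 1..t + m} = gap t"
    proof -
      have "gap t = (\<lambda>k. i t + (k - t)) ` {t + 1..t + m}"
      proof (intro equalityI subsetI)
        fix y assume "y \<in> gap t"
        then show "y \<in> (\<lambda>k. i t + (k - t)) ` {t + 1..t + m}"
          using it by (intro image_eqI[of _ _ "t + (y - i t)"]) (auto simp: gap_def)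
      qed (use it in \<open>auto simp: gap_def\<close>)
      then show top: "v ` {t + 1..t + m} = gap t"
        by (auto simp: v_def image_iff)
      have "{1..t + m} = {1..t} \<union> {t + 1..t + m}" using t by auto
      moreover have "v ` {1..t} = i ` {1..t}" by (auto simp: v_def)
      ultimately show "v ` {1..t + m} = i ` {1..t} \<union> gap t"
        using top by (simp add: image_Un)
    qed
    have Vn: "v ` {1..t + m} \<subseteq> {1..n}"
      unfolding V using t i_pos i_n itn it by (auto simp: gap_def)
    have sorted_rs: "sorted rs" by (simp add: rs_def)
    have set_rs: "set rs = {1..t}"
    proof -
      have "set rs = set_mset (\<Sum>r=1..t. replicate_mset (a r) r)"
        by (metis mset_rs set_mset_mset)
      also have "\<dots> = {1..t}" using a t by (auto simp: set_mset_sum)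
      finally show ?thesis .
    qed
    have A'_sub: "set_mset A' \<subseteq> i ` {t + 1..s}" by (auto simp: A'_def set_mset_sum)
    have A'_n: "set_mset A' \<subseteq> {1..n}"
    proof -
      have "i r \<in> {1..n}" if "r \<in> {t + 1..s}" for r
        using that t i_pos i_n[of r] by simp
      then show ?thesis using A'_sub by blast
    qed
    have A'_V: "set_mset A' \<inter> v ` {1..t + m} = {}"
    proof -
      have "y \<notin> i ` {1..t} \<union> gap t" if y: "y \<in> i ` {t + 1..s}" for y
      proof -
        obtain r where r: "r \<in> {t + 1..s}" "y = i r" using y by blast
        have "y \<notin> gap t" using r t gap_i[of r t] by simp
        moreover have "i k < y" if "k \<in> {1..t}" for k
          using i_less[of k r] r that by simp
        then have "y \<notin> i ` {1..t}" by (metis imageE less_irrefl)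
        ultimately show ?thesis by simp
      qed
      then show ?thesis unfolding V using A'_sub by (meson disjoint_iff subsetD)
    qed
    have "(length rs + m) choose m \<le>
      card {C \<in> borel_generalizations n (image_mset v (mset rs) + A').
            set_mset C \<subseteq> v ` {1..t + m} \<union> set_mset A' \<and>
            set_mset C \<inter> v ` {t + 1..t + m} \<noteq> {}} + 1"
      by (rule card_generalizations_through_gap[OF v Vn sorted_rs _ _ A'_n A'_V])
        (use set_rs t in simp_all)
    also have "image_mset v (mset rs) + A' = A"
    proof -
      have "image_mset v (mset rs) = (\<Sum>r=1..t. replicate_mset (a r) (i r))"
        by (simp add: mset_rs image_mset_sum_replicate v_def)
      moreover have "{1..s} = {1..t} \<union> {t + 1..s}" using t by auto
      ultimately show ?thesis
        unfolding A_def A'_def by (simp add: sum.union_disjoint)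
    qed
    also have "card {C \<in> borel_generalizations n A.
            set_mset C \<subseteq> v ` {1..t + m} \<union> set_mset A' \<and>
            set_mset C \<inter> v ` {t + 1..t + m} \<noteq> {}} \<le> card (Q t)"
    proof (rule card_mono)
      show "finite (Q t)" unfolding Q_def using finite_borel_generalizations by simp
      have "v ` {1..t + m} \<union> set_mset A' \<subseteq> i ` {1..s} \<union> gap t"
      proof -
        have "{1..t} \<subseteq> {1..s}" "{t + 1..s} \<subseteq> {1..s}" using t by auto
        then show ?thesis unfolding V using A'_sub by blast
      qed
      then show "{C \<in> borel_generalizations n A.
            set_mset C \<subseteq> v ` {1..t + m} \<union> set_mset A' \<and>
            set_mset C \<inter> v ` {t + 1..t + m} \<noteq> {}} \<subseteq> Q t"
        unfolding Q_def top by blast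
    qed
    also have "length rs = (\<Sum>r=1..t. a r)"
    proof -
      have "length rs = size (\<Sum>r=1..t. replicate_mset (a r) r)"
        by (metis mset_rs size_mset)
      then show ?thesis by simp
    qed
    finally show ?thesis by (simp add: m_def)
  qed

  have fin_Q: "finite (Q t)" for t
    unfolding Q_def using finite_borel_generalizations by simp
  have disj: "Q t \<inter> Q t' = {}" if "t \<in> {1..s}" "t' \<in> {1..s}" "t \<noteq> t'" for t t'
  proof -
    have "gap t \<inter> gap t' = {}"
      using that gap_gap[of t t'] gap_gap[of t' t] by (cases "t < t'") auto
    moreover have "i ` {1..s} \<inter> gap t' = {}" using gap_i that by auto
    ultimately show ?thesis unfolding Q_def by blast
  qed
  have "A \<notin> (\<Union>t\<in>{1..s}. Q t)"
    using set_A gap_i unfolding Q_def by blast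
  moreover have "insert A (\<Union>t\<in>{1..s}. Q t) \<subseteq> borel_generalizations n A"
  proof -
    have "i ` {1..s} \<subseteq> {1..n}" using i_pos i_n by auto
    with set_A have "A \<in> borel_generalizations n A"
      by (intro self_in_borel_generalizations) blast
    then show ?thesis unfolding Q_def by blast
  qed
  ultimately have "card (\<Union>t\<in>{1..s}. Q t) + 1 \<le> card (borel_generalizations n A)"
    using card_mono[OF finite_borel_generalizations, of "insert A (\<Union>t\<in>{1..s}. Q t)" n A] fin_Q
    by simp
  moreover have "card (\<Union>t\<in>{1..s}. Q t) = (\<Sum>t=1..s. card (Q t))"
    by (intro card_UN_disjoint) (use fin_Q disj in auto)
  moreover have "(\<Sum>t=1..s. ((\<Sum>r=1..t. a r) + (i (t + 1) - i t - 1)) choose (i (t + 1) - i t - 1))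
      \<le> (\<Sum>t=1..s. card (Q t) + 1)"
    by (intro sum_mono block)
  moreover have "(\<Sum>t=1..s. card (Q t) + 1) = (\<Sum>t=1..s. card (Q t)) + s"
    by (subst sum.distrib) simp
  ultimately show ?thesis by linarith
qed

section \<open>Monomials as multisets of variables\<close>

definition monom_of_mset :: "nat multiset \<Rightarrow> 'k::field mpoly" where
  "monom_of_mset M = (\<Prod>x\<in>#M. Var x)"

text \<open>
  In this form a monomial displays its exponent vector, whose entries are the
  multiplicities of \<open>M\<close>; this makes the encoding by multisets injective.
\<close>

lemma monom_of_mset_eq_single:
  "(monom_of_mset M :: 'k::field mpoly)
     = Poly_Mapping.single (\<Sum>x\<in>#M. Poly_Mapping.single x 1) 1"
  by (induction M) (simp_all add: monom_of_mset_def Var_def mult_single)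

lemma lookup_sum_single:
  "Poly_Mapping.lookup (\<Sum>x\<in>#M. Poly_Mapping.single x (1::nat)) k = count M k"
  by (induction M) (simp_all add: lookup_add lookup_single when_def)

lemma inj_monom_of_mset: "inj (monom_of_mset :: nat multiset \<Rightarrow> 'k::field mpoly)"
proof (rule injI)
  fix M N :: "nat multiset"
  let ?e = "\<lambda>M. \<Sum>x\<in>#M. Poly_Mapping.single x (1::nat)"
  assume "(monom_of_mset M :: 'k mpoly) = monom_of_mset N"
  then have "Poly_Mapping.single (?e M) (1::'k) = Poly_Mapping.single (?e N) 1"
    by (simp only: monom_of_mset_eq_single)
  then have "Poly_Mapping.keys (Poly_Mapping.single (?e M) (1::'k))
      = Poly_Mapping.keys (Poly_Mapping.single (?e N) (1::'k))"
    by (rule arg_cong)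
  then have "?e M = ?e N" by simp
  then show "M = N" by (metis lookup_sum_single multiset_eqI)
qed

lemma monom_of_mset_sum_replicate:
  assumes "finite I"
  shows "monom_of_mset (\<Sum>k\<in>I. replicate_mset (c k) (f k)) = (\<Prod>k\<in>I. Var (f k) ^ c k)"
  using assms
  by (induction I rule: finite_induct) (simp_all add: monom_of_mset_def)

lemma mset_eq_sum_replicate_count:
  assumes "set_mset M \<subseteq> I" and "finite I"
  shows "M = (\<Sum>k\<in>I. replicate_mset (count M k) k)"
proof (rule multiset_eqI)
  fix x
  have "count (\<Sum>k\<in>I. replicate_mset (count M k) k) x = (\<Sum>k\<in>I. if k = x then count M k else 0)"
    by (simp add: count_sum eq_commute)
  also have "\<dots> = count M x"
    using assms by (auto simp: sum.delta' not_in_iff[symmetric])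
  finally show "count M x = count (\<Sum>k\<in>I. replicate_mset (count M k) k) x" by simp
qed

text \<open>
  An exponent vector \<open>c\<close> on \<open>{1..n}\<close> corresponds to the multiset containing each \<open>k\<close> exactly \<open>c k\<close>
  times, and replacing variables in the monomial is taking the image of that multiset.
\<close>

lemma P_monom_of_mset:
  "P n (monom_of_mset A :: 'k::field mpoly) = monom_of_mset ` borel_generalizations n A"
proof (intro equalityI subsetI)
  fix C :: "'k mpoly"
  assume "C \<in> P n (monom_of_mset A)"
  then obtain c j where C: "C = xpow n c" and j: "\<forall>k\<in>{1..n}. 1 \<le> j k \<and> j k \<le> k"
    and A: "(monom_of_mset A :: 'k mpoly) = (\<Prod>k=1..n. Var (j k) ^ c k)"
    by (auto simp: P_def borel_specialization_def)
  define M where "M = (\<Sum>k=1..n. replicate_mset (c k) k)"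
  have "C = monom_of_mset M"
    by (simp add: C xpow_def M_def monom_of_mset_sum_replicate)
  moreover have "(monom_of_mset (image_mset j M) :: 'k mpoly) = monom_of_mset A"
    by (simp add: A M_def image_mset_sum_replicate monom_of_mset_sum_replicate)
  then have "image_mset j M = A" by (rule injD[OF inj_monom_of_mset])
  moreover have "set_mset M \<subseteq> {1..n}" by (auto simp: M_def set_mset_sum)
  ultimately show "C \<in> monom_of_mset ` borel_generalizations n A"
    using j by (auto simp: borel_generalizations_def)
next
  fix C :: "'k mpoly"
  assume "C \<in> monom_of_mset ` borel_generalizations n A"
  then obtain M j where C: "C = monom_of_mset M" and M: "set_mset M \<subseteq> {1..n}"
    and j: "\<forall>k\<in>{1..n}. 1 \<le> j k \<and> j k \<le> k" and A: "image_mset j M = A"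
    by (auto simp: borel_generalizations_def)
  have M_eq: "M = (\<Sum>k=1..n. replicate_mset (count M k) k)"
    using M by (intro mset_eq_sum_replicate_count) auto
  have "C = xpow n (count M)"
    unfolding C xpow_def by (subst M_eq) (simp add: monom_of_mset_sum_replicate)
  moreover have "(monom_of_mset A :: 'k mpoly) = (\<Prod>k=1..n. Var (j k) ^ count M k)"
    unfolding A[symmetric]
    by (subst M_eq) (simp add: image_mset_sum_replicate monom_of_mset_sum_replicate)
  ultimately show "C \<in> P n (monom_of_mset A)"
    using j by (auto simp: P_def monomials_def borel_specialization_def)
qed

section \<open>The bound for monomials\<close>

theorem theorem1p7:
  fixes n s :: nat
    and i \<alpha> :: "nat \<Rightarrow> nat"
    and xA :: "'k::field mpoly"
  assumes "strict_mono_on {1..s} i"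
    and "\<forall>t\<in>{1..s}. 1 \<le> i t \<and> i t \<le> n"
    and "\<forall>t\<in>{1..s}. \<alpha> (i t) > 0"
    and "i (s + 1) = n + 1"
    and "xA = (\<Prod>t=1..s. Var (i t) ^ \<alpha> (i t))"
  shows "int (card (P n xA)) \<ge>
    (\<Sum>t=1..s. int (((\<Sum>r=1..t. \<alpha> (i r)) + i (t + 1) - i t - 1) choose (i (t + 1) - i t - 1)))
      - int s + 1"
proof -
  let ?A = "\<Sum>t=1..s. replicate_mset (\<alpha> (i t)) (i t)"
  let ?m = "\<lambda>t. i (t + 1) - i t - 1"
  have i: "strict_mono_on {1..s + 1} i"
  proof (rule strict_mono_onI)
    fix r t assume rt: "r \<in> {1..s + 1}" "t \<in> {1..s + 1}" "r < t"
    show "i r < i t"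
    proof (cases "t = s + 1")
      case True
      with rt assms(2,4) show ?thesis by (auto simp: less_Suc_eq_le)
    next
      case False
      with rt show ?thesis by (intro strict_mono_onD[OF assms(1)]) auto
    qed
  qed
  have bound: "(\<Sum>t=1..s. ((\<Sum>r=1..t. \<alpha> (i r)) + ?m t) choose ?m t) + 1
      \<le> card (borel_generalizations n ?A) + s"
    using assms(2,3,4) i by (intro card_borel_generalizations_ge) auto
  have "xA = monom_of_mset ?A" by (simp add: assms(5) monom_of_mset_sum_replicate)
  then have "card (P n xA) = card (borel_generalizations n ?A)"
    by (simp add: P_monom_of_mset card_image inj_on_subset[OF inj_monom_of_mset])
  moreover have "(\<Sum>r=1..t. \<alpha> (i r)) + i (t + 1) - i t - 1 = (\<Sum>r=1..t. \<alpha> (i r)) + ?m t"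
    if "t \<in> {1..s}" for t
    using strict_mono_onD[OF i, of t "t + 1"] that by simp
  then have "(\<Sum>t=1..s. int (((\<Sum>r=1..t. \<alpha> (i r)) + i (t + 1) - i t - 1) choose ?m t))
      = int (\<Sum>t=1..s. ((\<Sum>r=1..t. \<alpha> (i r)) + ?m t) choose ?m t)"
    unfolding of_nat_sum by (intro sum.cong) simp_all
  ultimately show ?thesis using bound by linarith
qed

end
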